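(* Let $M$ be a smooth compact 3-dimensional manifold, and let $(\omega,T)$ and $(\tilde\omega,\tilde T)$ be two pairs, each consisting of a smooth 1-form and a smooth vector field on $M$, with $\omega(T)=1=\tilde\omega(\tilde T)$. Put $\mathcal D=\ker\omega$, $\eta=\iota_T\,d\omega$ and $\tilde\eta=\iota_{\tilde T}\,d\tilde\omega$. (i) If $\tilde T=e^{-f}T$ for a smooth function $f$ on $M$ and $\tilde\omega$ is parallel to $\omega$ (pointwise proportional), then $\tilde\omega=e^{f}\omega$ and $$\tilde\eta\wedge d\tilde\eta=\eta\wedge d\eta+d\alpha+2\,T(f)\,\omega\wedge d\eta+T(f)^2\,\omega\wedge d\omega,$$ where $\alpha$ is the 2-form $\alpha=-f\,d\eta-f\,d(T(f)\,\omega)+T(f)\,\omega\wedge\eta$. (ii) If $\tilde T=T+X$ for some vector field $X$ tangent to $\mathcal D$ and $\tilde\omega=\omega$, then $\tilde\eta=\eta+\iota_X\,d\omega$ and $$\tilde\eta\wedge d\tilde\eta=\eta\wedge d\eta-d(\eta\wedge\iota_X d\omega)+2\,d\eta\wedge\iota_X d\omega+(\iota_X d\omega)\wedge d(\iota_X d\omega).$$ (iii) If $\tilde T=T$ and $\tilde\omega=\omega+\mu$ for some 1-form $\mu$, then $\mu(T)=0$, $\tilde\eta=\eta+\iota_T\,d\mu$ and $$\tilde\eta\wedge d\tilde\eta=\eta\wedge d\eta-d(\eta\wedge\iota_T d\mu)+2\,d\eta\wedge\iota_T d\mu+(\iota_T d\mu)\wedge d(\iota_T d\mu).$$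
   Context: $\iota_Z$ denotes interior product, $\iota_Z d\omega=d\omega(Z,\cdot)$, and $d\alpha(X,Y)=X(\alpha(Y))-Y(\alpha(X))-\alpha([X,Y])$ for a 1-form $\alpha$. $T(f)$ is the derivative of $f$ along $T$. *)

theory Defs
  imports "HOL-Analysis.Analysis" "HOL-Library.Function_Algebras"
begin

text \<open>For open \<open>S\<close> in a finite-dimensional space, \<open>Ck_on k f S\<close> is the usual notion of a \<open>C\<^sup>k\<close> map.\<close>

fun Ck_on :: "nat \<Rightarrow> ('a::real_normed_vector \<Rightarrow> 'b::real_normed_vector) \<Rightarrow> 'a set \<Rightarrow> bool" where
  "Ck_on 0 f S \<longleftrightarrow> continuous_on S f"
| "Ck_on (Suc k) f S \<longleftrightarrow>
     (\<forall>x\<in>S. f differentiable (at x)) \<and> (\<forall>v. Ck_on k (\<lambda>x. frechet_derivative f (at x) v) S)"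

definition smooth_on :: "('a::real_normed_vector \<Rightarrow> 'b::real_normed_vector) \<Rightarrow> 'a set \<Rightarrow> bool" where
  "smooth_on f S \<longleftrightarrow> (\<forall>k. Ck_on k f S)"

text \<open>The manifold is the whole type \<open>'a\<close>. A chart is a pair of its domain and its coordinate map,
  so only the values of the map on the domain matter. There is no boundary.\<close>

definition chart :: "'a::topological_space set \<times> ('a \<Rightarrow> 'e::euclidean_space) \<Rightarrow> bool" where
  "chart c \<longleftrightarrow> (case c of (U, \<phi>) \<Rightarrow>
     open U \<and> open (\<phi> ` U) \<and> homeomorphism U (\<phi> ` U) \<phi> (inv_into U \<phi>))"

definition smooth_atlas :: "('a::topological_space set \<times> ('a \<Rightarrow> 'e::euclidean_space)) set \<Rightarrow> bool" where
  "smooth_atlas A \<longleftrightarrow>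
     (\<forall>c\<in>A. chart c) \<and> (\<Union>c\<in>A. fst c) = UNIV \<and>
     (\<forall>(U, \<phi>)\<in>A. \<forall>(V, \<psi>)\<in>A. smooth_on (\<psi> \<circ> inv_into U \<phi>) (\<phi> ` (U \<inter> V)))"

text \<open>A compact space with an atlas of this kind is automatically second countable, so together with
  the class \<open>t2_space\<close> these are all the axioms of a compact smooth manifold of dimension \<open>DIM('e)\<close>.
  The atlas need not be maximal; it determines the smooth structure.\<close>

definition compact_smooth_manifold :: "('a::t2_space set \<times> ('a \<Rightarrow> 'e::euclidean_space)) set \<Rightarrow> bool" where
  "compact_smooth_manifold A \<longleftrightarrow> compact (UNIV :: 'a set) \<and> smooth_atlas A"

definition smooth_fun :: "('a::topological_space set \<times> ('a \<Rightarrow> 'e::euclidean_space)) set \<Rightarrow> ('a \<Rightarrow> real) \<Rightarrow> bool" where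
  "smooth_fun A f \<longleftrightarrow> (\<forall>(U, \<phi>)\<in>A. smooth_on (f \<circ> inv_into U \<phi>) (\<phi> ` U))"

text \<open>As in Helgason's \<^emph>\<open>Differential Geometry, Lie Groups, and Symmetric Spaces\<close>, Chapter I, smooth
  vector fields are the derivations of the algebra \<open>C\<^sup>\<infinity>(M)\<close>, and smooth \<open>k\<close>-forms are the alternating
  \<open>C\<^sup>\<infinity>(M)\<close>-multilinear maps from \<open>k\<close> vector fields to \<open>C\<^sup>\<infinity>(M)\<close>. Thus \<open>X f\<close> is the derivative of
  \<open>f\<close> along \<open>X\<close>, and \<open>\<omega> X\<close> is the function \<open>p \<mapsto> \<omega>\<^sub>p(X\<^sub>p)\<close>.
  Vector fields are set to 0 on functions that are not smooth, and forms are set to 0 on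
  arguments that are not vector fields, so that equality of these objects is equality in HOL.
  Sums and differences of functions, vector fields and forms are the pointwise ones
  of \<open>Function_Algebras\<close>.\<close>

type_synonym 'a vfield = "('a \<Rightarrow> real) \<Rightarrow> 'a \<Rightarrow> real"
type_synonym 'a form1 = "'a vfield \<Rightarrow> 'a \<Rightarrow> real"
type_synonym 'a form2 = "'a vfield \<Rightarrow> 'a vfield \<Rightarrow> 'a \<Rightarrow> real"
type_synonym 'a form3 = "'a vfield \<Rightarrow> 'a vfield \<Rightarrow> 'a vfield \<Rightarrow> 'a \<Rightarrow> real"

definition vector_field :: "('a::topological_space set \<times> ('a \<Rightarrow> 'e::euclidean_space)) set \<Rightarrow> 'a vfield \<Rightarrow> bool" where
  "vector_field A X \<longleftrightarrow>
     (\<forall>f. smooth_fun A f \<longrightarrow> smooth_fun A (X f)) \<and>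
     (\<forall>f g a b. smooth_fun A f \<longrightarrow> smooth_fun A g \<longrightarrow>
        X (\<lambda>p. a * f p + b * g p) = (\<lambda>p. a * X f p + b * X g p)) \<and>
     (\<forall>f g. smooth_fun A f \<longrightarrow> smooth_fun A g \<longrightarrow>
        X (\<lambda>p. f p * g p) = (\<lambda>p. X f p * g p + f p * X g p)) \<and>
     (\<forall>f. \<not> smooth_fun A f \<longrightarrow> X f = (\<lambda>p. 0))"

definition lie_bracket :: "'a vfield \<Rightarrow> 'a vfield \<Rightarrow> 'a vfield" where
  "lie_bracket X Y = (\<lambda>f p. X (Y f) p - Y (X f) p)"

text \<open>Multiplication by functions; \<open>\<cdot>\<^sub>1\<close> serves for vector fields as well as for 1-forms.\<close>

definition scale1 :: "('a \<Rightarrow> real) \<Rightarrow> ('b \<Rightarrow> 'a \<Rightarrow> real) \<Rightarrow> ('b \<Rightarrow> 'a \<Rightarrow> real)" (infixr "\<cdot>\<^sub>1" 75) where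
  "h \<cdot>\<^sub>1 \<alpha> = (\<lambda>X p. h p * \<alpha> X p)"

definition scale2 :: "('a \<Rightarrow> real) \<Rightarrow> 'a form2 \<Rightarrow> 'a form2" (infixr "\<cdot>\<^sub>2" 75) where
  "h \<cdot>\<^sub>2 \<theta> = (\<lambda>X Y p. h p * \<theta> X Y p)"

definition scale3 :: "('a \<Rightarrow> real) \<Rightarrow> 'a form3 \<Rightarrow> 'a form3" (infixr "\<cdot>\<^sub>3" 75) where
  "h \<cdot>\<^sub>3 \<theta> = (\<lambda>X Y Z p. h p * \<theta> X Y Z p)"

definition one_form :: "('a::topological_space set \<times> ('a \<Rightarrow> 'e::euclidean_space)) set \<Rightarrow> 'a form1 \<Rightarrow> bool" where
  "one_form A \<omega> \<longleftrightarrow>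
     (\<forall>X. vector_field A X \<longrightarrow> smooth_fun A (\<omega> X)) \<and>
     (\<forall>X Y. vector_field A X \<longrightarrow> vector_field A Y \<longrightarrow> \<omega> (X + Y) = \<omega> X + \<omega> Y) \<and>
     (\<forall>h X. smooth_fun A h \<longrightarrow> vector_field A X \<longrightarrow> \<omega> (h \<cdot>\<^sub>1 X) = (\<lambda>p. h p * \<omega> X p)) \<and>
     (\<forall>X. \<not> vector_field A X \<longrightarrow> \<omega> X = (\<lambda>p. 0))"

text \<open>The normalisation is without the factor \<open>1/(k+1)\<close>.\<close>

definition ext_deriv1 :: "('a::topological_space set \<times> ('a \<Rightarrow> 'e::euclidean_space)) set \<Rightarrow> 'a form1 \<Rightarrow> 'a form2" where
  "ext_deriv1 A \<alpha> = (\<lambda>X Y p.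
     if vector_field A X \<and> vector_field A Y
     then X (\<alpha> Y) p - Y (\<alpha> X) p - \<alpha> (lie_bracket X Y) p
     else 0)"

definition ext_deriv2 :: "('a::topological_space set \<times> ('a \<Rightarrow> 'e::euclidean_space)) set \<Rightarrow> 'a form2 \<Rightarrow> 'a form3" where
  "ext_deriv2 A \<theta> = (\<lambda>X Y Z p.
     if vector_field A X \<and> vector_field A Y \<and> vector_field A Z
     then X (\<theta> Y Z) p - Y (\<theta> X Z) p + Z (\<theta> X Y) p
        - \<theta> (lie_bracket X Y) Z p + \<theta> (lie_bracket X Z) Y p - \<theta> (lie_bracket Y Z) X p
     else 0)"

definition interior_product :: "'a vfield \<Rightarrow> 'a form2 \<Rightarrow> 'a form1" where
  "interior_product Z \<theta> = (\<lambda>X. \<theta> Z X)"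

text \<open>Wedge products in the normalisation matching that of the exterior derivative,
  that is \<open>d(f \<omega>) = df \<and> \<omega> + f d\<omega>\<close>. The subscripts are the degrees of the factors.\<close>

definition wedge11 :: "'a form1 \<Rightarrow> 'a form1 \<Rightarrow> 'a form2" (infixr "\<and>\<^sub>1\<^sub>1" 70) where
  "\<alpha> \<and>\<^sub>1\<^sub>1 \<beta> = (\<lambda>X Y p. \<alpha> X p * \<beta> Y p - \<alpha> Y p * \<beta> X p)"

definition wedge12 :: "'a form1 \<Rightarrow> 'a form2 \<Rightarrow> 'a form3" (infixr "\<and>\<^sub>1\<^sub>2" 70) where
  "\<alpha> \<and>\<^sub>1\<^sub>2 \<theta> = (\<lambda>X Y Z p. \<alpha> X p * \<theta> Y Z p - \<alpha> Y p * \<theta> X Z p + \<alpha> Z p * \<theta> X Y p)"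

definition wedge21 :: "'a form2 \<Rightarrow> 'a form1 \<Rightarrow> 'a form3" (infixr "\<and>\<^sub>2\<^sub>1" 70) where
  "\<theta> \<and>\<^sub>2\<^sub>1 \<alpha> = (\<lambda>X Y Z p. \<theta> X Y p * \<alpha> Z p - \<theta> X Z p * \<alpha> Y p + \<theta> Y Z p * \<alpha> X p)"

text \<open>\<open>parallel_to A \<omega>' \<omega>\<close>: at each point \<open>p\<close>, \<open>\<omega>'\<^sub>p\<close> is a real multiple of \<open>\<omega>\<^sub>p\<close>. Every tangent vector at
  \<open>p\<close> is the value of some vector field, so the multiple is tested on vector fields.\<close>

definition parallel_to :: "('a::topological_space set \<times> ('a \<Rightarrow> 'e::euclidean_space)) set \<Rightarrow> 'a form1 \<Rightarrow> 'a form1 \<Rightarrow> bool" where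
  "parallel_to A \<omega>' \<omega> \<longleftrightarrow> (\<forall>p. \<exists>c. \<forall>X. vector_field A X \<longrightarrow> \<omega>' X p = c * \<omega> X p)"

text \<open>The plane field \<open>ker \<omega>\<close> is represented by its module of sections, the vector fields tangent to it.\<close>

definition ker_form :: "('a::topological_space set \<times> ('a \<Rightarrow> 'e::euclidean_space)) set \<Rightarrow> 'a form1 \<Rightarrow> 'a vfield set" where
  "ker_form A \<omega> = {X. vector_field A X \<and> (\<forall>p. \<omega> X p = 0)}"

end

theory Submission
  imports Defs
begin

text \<open>All three formulas come from one computation: \<open>\<eta>'\<close> differs from \<open>\<eta>\<close> by an explicit
  one-form, and \<open>\<eta>' \<and> d\<eta>'\<close> is then expanded with the Cartan rules for \<open>d\<close>.

  In (ii) and (iii) the difference is \<open>\<beta> = \<iota>\<^sub>X d\<omega>\<close> or \<open>\<beta> = \<iota>\<^sub>T d\<mu>\<close>, because \<open>\<iota>\<close> is additive in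
  the field and \<open>d\<close> in the form. In \<open>(\<eta> + \<beta>) \<and> d(\<eta> + \<beta>)\<close> the mixed terms are
  \<open>\<beta> \<and> d\<eta> = d\<eta> \<and> \<beta>\<close> and, by the Leibniz rule, \<open>\<eta> \<and> d\<beta> = d\<eta> \<and> \<beta> - d(\<eta> \<and> \<beta>)\<close>
  (\<open>wedge_ext_deriv1_perturbed\<close>).

  In (i), evaluating \<open>\<omega>'(T') = 1\<close> fixes the proportionality factor to be \<open>e\<^sup>f\<close>
  (\<open>parallel_conformal_factor\<close>). From \<open>d(e\<^sup>f \<omega>) = e\<^sup>f (df \<and> \<omega> + d\<omega>)\<close> one gets
  \<open>\<eta>' = \<eta> + T(f) \<omega> - df\<close> (\<open>interior_conformal\<close>). Since \<open>dd = 0\<close>, the terms with \<open>df\<close>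
  are the exact forms \<open>- d(f d\<eta>)\<close> and \<open>- d(f d(T(f) \<omega>))\<close>; the mixed terms of \<open>\<eta>\<close> and
  \<open>g \<omega>\<close>, with \<open>g = T(f)\<close>, give \<open>d(g \<omega> \<and> \<eta>) + 2 g \<omega> \<and> d\<eta>\<close>; and
  \<open>g \<omega> \<and> d(g \<omega>) = g\<^sup>2 \<omega> \<and> d\<omega>\<close> because \<open>\<omega> \<and> dg \<and> \<omega> = 0\<close>
  (\<open>wedge_ext_deriv1_conformal\<close>).

  As vector fields are derivations of the algebra of smooth functions, the rules for \<open>d\<close> are
  pure algebra: the Leibniz rules follow from the product rule and \<open>dd = 0\<close> from the Jacobi
  identity. Analysis enters at two points: the smooth functions must be closed under sums, products
  and the exponential, and a derivation must obey the chain rule \<open>X(e\<^sup>f) = e\<^sup>f X(f)\<close>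
  (\<open>vf_exp\<close>).\<close>

section \<open>Smooth functions\<close>

text \<open>The derivative of a function outside \<open>S\<close> is arbitrary, so the formulas for derivatives of
  sums, products and composites hold on \<open>S\<close> only. This congruence lets the inductions
  on \<open>k\<close> replace the derivative by such a formula; openness of \<open>S\<close> makes the derivative at a point of
  \<open>S\<close> depend on the values in \<open>S\<close> alone.\<close>

lemma Ck_on_cong:
  assumes "open S" "\<And>x. x \<in> S \<Longrightarrow> f x = g x" "Ck_on k f S"
  shows "Ck_on k g S"
  using assms
proof (induction k arbitrary: f g)
  case 0
  then show ?case by (auto cong: continuous_on_cong)
next
  case (Suc k)
  have D: "(g has_derivative frechet_derivative f (at x)) (at x)" if "x \<in> S" for x
  proof -
    have "(f has_derivative frechet_derivative f (at x)) (at x)"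
      using Suc.prems(3) that frechet_derivative_works by auto
    then show ?thesis
      using has_derivative_transform_within_open Suc.prems(1,2) that by blast
  qed
  have "Ck_on k (\<lambda>x. frechet_derivative g (at x) v) S" for v
  proof (rule Suc.IH[where f = "\<lambda>x. frechet_derivative f (at x) v"])
    show "frechet_derivative f (at x) v = frechet_derivative g (at x) v" if "x \<in> S" for x
      using frechet_derivative_at[OF D[OF that]] by simp
  qed (use Suc.prems in auto)
  with D show ?case by (auto simp: differentiable_def)
qed

lemma Ck_on_SucD: "Ck_on (Suc k) f S \<Longrightarrow> Ck_on k f S"
proof (induction k arbitrary: f)
  case 0
  then show ?case
    by (auto intro!: continuous_at_imp_continuous_on differentiable_imp_continuous_within)
next
  case (Suc k)
  then show ?case by (metis Ck_on.simps(2))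
qed

lemma Ck_on_SucI:
  assumes "open S" "\<And>x. x \<in> S \<Longrightarrow> (f has_derivative f' x) (at x)"
    "\<And>v. Ck_on k (\<lambda>x. f' x v) S"
  shows "Ck_on (Suc k) f S"
proof -
  have "Ck_on k (\<lambda>x. frechet_derivative f (at x) v) S" for v
    by (rule Ck_on_cong[OF assms(1) _ assms(3)[of v]]) (simp add: frechet_derivative_at[OF assms(2), symmetric])
  with assms(2) show ?thesis by (auto simp: differentiable_def)
qed

lemma Ck_on_SucE:
  assumes "Ck_on (Suc k) f S"
  shows "\<And>x. x \<in> S \<Longrightarrow> (f has_derivative frechet_derivative f (at x)) (at x)"
    and "\<And>v. Ck_on k (\<lambda>x. frechet_derivative f (at x) v) S"
  using assms frechet_derivative_works by auto

lemma Ck_on_const: "open S \<Longrightarrow> Ck_on k (\<lambda>x. c) S"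
proof (induction k arbitrary: c)
  case (Suc k)
  show ?case
    by (rule Ck_on_SucI[where f' = "\<lambda>x v. 0"]) (use Suc in auto)
qed simp

lemma Ck_on_add:
  "open S \<Longrightarrow> Ck_on k f S \<Longrightarrow> Ck_on k g S \<Longrightarrow> Ck_on k (\<lambda>x. f x + g x) S"
proof (induction k arbitrary: f g)
  case 0
  then show ?case by (auto intro: continuous_on_add)
next
  case (Suc k)
  note f = Ck_on_SucE[OF Suc.prems(2)] and g = Ck_on_SucE[OF Suc.prems(3)]
  show ?case
    by (rule Ck_on_SucI[OF Suc.prems(1) has_derivative_add[OF f(1) g(1)]])
      (use Suc.IH[OF Suc.prems(1) f(2) g(2)] in auto)
qed

lemma Ck_on_mult:
  fixes f g :: "'a::real_normed_vector \<Rightarrow> real"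
  shows "open S \<Longrightarrow> Ck_on k f S \<Longrightarrow> Ck_on k g S \<Longrightarrow> Ck_on k (\<lambda>x. f x * g x) S"
proof (induction k arbitrary: f g)
  case 0
  then show ?case by (auto intro: continuous_on_mult)
next
  case (Suc k)
  note f = Ck_on_SucE[OF Suc.prems(2)] and g = Ck_on_SucE[OF Suc.prems(3)]
  show ?case
    by (rule Ck_on_SucI[OF Suc.prems(1) has_derivative_mult[OF f(1) g(1)]])
      (use Suc f g in \<open>auto intro!: Ck_on_add Suc.IH intro: Ck_on_SucD simp del: Ck_on.simps\<close>)
qed

text \<open>Stating the chain rule for a sequence in which each function is the derivative of its
  predecessor makes the induction on the order of differentiability close up: the derivative
  of the composite is a product of \<open>F (Suc n)\<close> composed with \<open>g\<close> and a derivative of \<open>g\<close>.\<close>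

lemma Ck_on_compose_derivs:
  fixes F :: "nat \<Rightarrow> real \<Rightarrow> real" and g :: "'a::real_normed_vector \<Rightarrow> real"
  assumes F: "\<And>n t. (F n has_real_derivative F (Suc n) t) (at t)" and S: "open S"
  shows "Ck_on k g S \<Longrightarrow> Ck_on k (\<lambda>x. F n (g x)) S"
proof (induction k arbitrary: n)
  case 0
  have "continuous_on UNIV (F n)"
    using F DERIV_isCont by (blast intro: continuous_at_imp_continuous_on)
  with 0 show ?case by (auto intro: continuous_on_compose2)
next
  case (Suc k)
  note g = Ck_on_SucE[OF Suc.prems]
  have "((\<lambda>x. F n (g x)) has_derivative (\<lambda>v. frechet_derivative g (at x) v * F (Suc n) (g x))) (at x)"
    if "x \<in> S" for x
    using DERIV_compose_FDERIV[OF F g(1)[OF that]] .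
  then show ?case
    by (rule Ck_on_SucI[OF S]) (use Suc g in \<open>auto intro!: Ck_on_mult S intro: Ck_on_SucD simp del: Ck_on.simps\<close>)
qed

locale atlas =
  fixes A :: "('a::topological_space set \<times> ('a \<Rightarrow> 'e::euclidean_space)) set"
  assumes atlas: "smooth_atlas A"
begin

lemma open_chart_image: "(U, \<phi>) \<in> A \<Longrightarrow> open (\<phi> ` U)"
  using atlas by (auto simp: smooth_atlas_def chart_def)

lemma smooth_const: "smooth_fun A (\<lambda>p. c)"
  by (auto simp: smooth_fun_def smooth_on_def o_def intro: Ck_on_const open_chart_image)

lemma smooth_add: "smooth_fun A f \<Longrightarrow> smooth_fun A g \<Longrightarrow> smooth_fun A (\<lambda>p. f p + g p)"
  unfolding smooth_fun_def smooth_on_def o_def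
  by (fast intro: Ck_on_add open_chart_image)

lemma smooth_mult: "smooth_fun A f \<Longrightarrow> smooth_fun A g \<Longrightarrow> smooth_fun A (\<lambda>p. f p * g p)"
  unfolding smooth_fun_def smooth_on_def o_def
  by (fast intro: Ck_on_mult open_chart_image)

lemma smooth_compose_derivs:
  assumes "\<And>n t. (F n has_real_derivative F (Suc n) t) (at t)" and "smooth_fun A f"
  shows "smooth_fun A (\<lambda>p. F n (f p))"
  using assms(2) unfolding smooth_fun_def smooth_on_def o_def
  by (fast intro: Ck_on_compose_derivs[of F, OF assms(1)] open_chart_image)

lemma smooth_minus: "smooth_fun A f \<Longrightarrow> smooth_fun A (\<lambda>p. - f p)"
  using smooth_mult[OF smooth_const[of "-1"]] by fastforce

lemma smooth_diff: "smooth_fun A f \<Longrightarrow> smooth_fun A g \<Longrightarrow> smooth_fun A (\<lambda>p. f p - g p)"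
  using smooth_add[OF _ smooth_minus] by fastforce

lemma smooth_exp: "smooth_fun A f \<Longrightarrow> smooth_fun A (\<lambda>p. exp (f p))"
  by (rule smooth_compose_derivs[where F = "\<lambda>n. exp"]) (auto intro: DERIV_exp)

lemmas smooth_intros =
  smooth_const smooth_add smooth_mult smooth_minus smooth_diff smooth_exp

end

section \<open>Derivations and the chain rule for the exponential\<close>

text \<open>The second-order Taylor remainder of the exponential, divided by \<open>t\<^sup>2\<close>, is an entire
  power series; the sequence \<open>F\<close> consists of its successive derivatives.\<close>

lemma exp_remainder_smooth:
  obtains F :: "nat \<Rightarrow> real \<Rightarrow> real"
  where "\<And>n t. (F n has_real_derivative F (Suc n) t) (at t)"
    and "\<And>t. exp t = 1 + t + t * (t * F 0 t)"
proof -
  (* the coefficients of the n-th derivative, by formal differentiation *)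
  define c :: "nat \<Rightarrow> nat \<Rightarrow> real" where "c n = (diffs ^^ n) (\<lambda>k. 1 / fact (k + 2))" for n
  define F where "F n t = (\<Sum>k. c n k * t ^ k)" for n t
  have c0: "summable (\<lambda>k. c 0 k * t ^ k)" and F0: "exp t = 1 + t + t * (t * F 0 t)" for t
  proof -
    have e: "(\<lambda>n. t ^ n / fact n) sums exp t"
      using exp_converges[of t] by (simp add: divide_inverse mult.commute)
    have "(\<lambda>k. t ^ (k + 2) / fact (k + 2)) sums (exp t - (\<Sum>i<2. t ^ i / fact i))"
      by (rule sums_split_initial_segment[OF e])
    then have s: "(\<lambda>k. t * (t * (c 0 k * t ^ k))) sums (exp t - 1 - t)"
      by (simp add: c_def numeral_2_eq_2 field_simps)
    show sm: "summable (\<lambda>k. c 0 k * t ^ k)"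
    proof (cases "t = 0")
      case True
      then show ?thesis by (simp add: summable_0_powser)
    next
      case False
      then show ?thesis using sums_summable[OF s] by (simp add: summable_cmult_iff)
    qed
    have "(\<lambda>k. t * (t * (c 0 k * t ^ k))) sums (t * (t * F 0 t))"
      unfolding F_def by (intro sums_mult summable_sums sm)
    with s show "exp t = 1 + t + t * (t * F 0 t)"
      using sums_unique2 by fastforce
  qed
  have sm: "\<forall>t. summable (\<lambda>k. c n k * t ^ k)" for n
  proof (induction n)
    case (Suc n)
    then show ?case unfolding c_def funpow.simps o_def by (auto intro: termdiff_converges_all)
  qed (simp add: c0)
  have "(F n has_real_derivative F (Suc n) t) (at t)" for n t
  proof -
    have [abs_def]: "F (Suc n) t = (\<Sum>k. diffs (c n) k * t ^ k)" for t
      by (simp add: F_def c_def)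
    then show ?thesis
      unfolding F_def[of n, abs_def]
      using termdiffs_strong_converges_everywhere[of "c n" t] sm by simp
  qed
  with F0 that show ?thesis by blast
qed

context atlas
begin

lemma vf_smooth: "vector_field A X \<Longrightarrow> smooth_fun A f \<Longrightarrow> smooth_fun A (X f)"
  by (simp add: vector_field_def)

lemma vf_not_smooth: "vector_field A X \<Longrightarrow> \<not> smooth_fun A f \<Longrightarrow> X f = (\<lambda>p. 0)"
  by (simp add: vector_field_def)

lemma vf_linear: "vector_field A X \<Longrightarrow> smooth_fun A f \<Longrightarrow> smooth_fun A g \<Longrightarrow>
    X (\<lambda>p. a * f p + b * g p) = (\<lambda>p. a * X f p + b * X g p)"
  by (simp add: vector_field_def)

lemma vf_mult: "vector_field A X \<Longrightarrow> smooth_fun A f \<Longrightarrow> smooth_fun A g \<Longrightarrow>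
    X (\<lambda>p. f p * g p) = (\<lambda>p. X f p * g p + f p * X g p)"
  by (simp add: vector_field_def)

lemma vf_add: "vector_field A X \<Longrightarrow> smooth_fun A f \<Longrightarrow> smooth_fun A g \<Longrightarrow>
    X (\<lambda>p. f p + g p) = (\<lambda>p. X f p + X g p)"
  using vf_linear[of X f g 1 1] by simp

lemma vf_diff: "vector_field A X \<Longrightarrow> smooth_fun A f \<Longrightarrow> smooth_fun A g \<Longrightarrow>
    X (\<lambda>p. f p - g p) = (\<lambda>p. X f p - X g p)"
  using vf_linear[of X f g 1 "-1"] by simp

lemma vf_minus: "vector_field A X \<Longrightarrow> smooth_fun A f \<Longrightarrow> X (\<lambda>p. - f p) = (\<lambda>p. - X f p)"
  using vf_linear[of X f f "-1" 0] by simp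

lemma vf_const:
  assumes "vector_field A X"
  shows "X (\<lambda>p. c) = (\<lambda>p. 0)"
proof
  fix p
  have "X (\<lambda>p. 1) p = X (\<lambda>p. 1) p + X (\<lambda>p. 1) p"
    using fun_cong[OF vf_mult[OF assms smooth_const[of 1] smooth_const[of 1]], of p] by simp
  then show "X (\<lambda>p. c) p = 0"
    using fun_cong[OF vf_linear[OF assms smooth_const[of 1] smooth_const[of 1], of c 0], of p] by simp
qed

lemmas vf_simps = vf_add vf_diff vf_minus vf_mult vf_const

text \<open>A derivation is only known to satisfy the product rule, so the chain rule has to come from a
  Taylor expansion: at \<open>p\<close>, with \<open>s = f - f p\<close>, the remainder of \<open>exp s\<close> is a product of
  \<open>s\<close> and \<open>s H\<close>, both vanishing at \<open>p\<close>, and is therefore annihilated at \<open>p\<close>.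
  The remainder is smooth on the whole space, so the product rule applies to it directly.\<close>

lemma vf_exp:
  assumes X: "vector_field A X" and f: "smooth_fun A f"
  shows "X (\<lambda>p. exp (f p)) = (\<lambda>p. exp (f p) * X f p)"
proof
  fix p
  obtain F :: "nat \<Rightarrow> real \<Rightarrow> real" where F: "\<And>n t. (F n has_real_derivative F (Suc n) t) (at t)"
    and e: "\<And>t. exp t = 1 + t + t * (t * F 0 t)"
    using exp_remainder_smooth by blast
  define s where "s = (\<lambda>q. f q - f p)"
  define H where "H = (\<lambda>q. F 0 (s q))"
  have s: "smooth_fun A s" unfolding s_def by (intro smooth_intros f)
  have H: "smooth_fun A H" unfolding H_def by (rule smooth_compose_derivs[of F, OF F s])
  have "exp (f q) = exp (f p) * (1 + s q + s q * (s q * H q))" for q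
    using e[of "s q"] exp_add[of "f p" "s q"] by (simp add: H_def s_def)
  then have "(\<lambda>q. exp (f q)) = (\<lambda>q. exp (f p) * (1 + s q + s q * (s q * H q)))"
    by (rule ext)
  then have "X (\<lambda>q. exp (f q)) p = X (\<lambda>q. exp (f p) * (1 + s q + s q * (s q * H q))) p"
    by (rule arg_cong[where f = "\<lambda>u. X u p"])
  also have "\<dots> = exp (f p) * X s p"
    by (simp add: vf_simps[OF X] s H smooth_intros) (simp add: s_def)
  also have "X s p = X f p"
    unfolding s_def by (simp add: vf_simps[OF X] f smooth_intros)
  finally show "X (\<lambda>p. exp (f p)) p = exp (f p) * X f p" .
qed

lemma vector_field_add:
  assumes "vector_field A X" "vector_field A Y"
  shows "vector_field A (X + Y)"
  unfolding vector_field_def plus_fun_def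
  using assms
  by (auto simp: vf_smooth vf_linear vf_mult vf_not_smooth algebra_simps intro!: smooth_intros)

lemma vector_field_scale:
  assumes "vector_field A X" "smooth_fun A h"
  shows "vector_field A (h \<cdot>\<^sub>1 X)"
  unfolding vector_field_def scale1_def
  using assms
  by (auto simp: vf_smooth vf_linear vf_mult vf_not_smooth algebra_simps intro!: smooth_intros)

lemma vector_field_bracket:
  assumes X: "vector_field A X" and Y: "vector_field A Y"
  shows "vector_field A (lie_bracket X Y)"
  unfolding vector_field_def lie_bracket_def
proof (intro conjI allI impI)
  fix f g :: "'a \<Rightarrow> real" and a b :: real
  assume f: "smooth_fun A f" and g: "smooth_fun A g"
  have mult: "P (Q (\<lambda>p. f p * g p)) =
      (\<lambda>p. (P (Q f) p * g p + Q f p * P g p) + (P f p * Q g p + f p * P (Q g) p))"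
    if P: "vector_field A P" and Q: "vector_field A Q" for P Q
    using f g vf_smooth[OF Q f] vf_smooth[OF Q g]
    by (simp only: vf_mult[OF Q] vf_add[OF P] vf_mult[OF P] smooth_mult)
  show "(\<lambda>p. X (Y (\<lambda>p. a * f p + b * g p)) p - Y (X (\<lambda>p. a * f p + b * g p)) p) =
    (\<lambda>p. a * (X (Y f) p - Y (X f) p) + b * (X (Y g) p - Y (X g) p))"
    using f g by (simp only: vf_linear[OF X] vf_linear[OF Y] vf_smooth[OF X] vf_smooth[OF Y])
      (simp add: algebra_simps)
  show "(\<lambda>p. X (Y (\<lambda>p. f p * g p)) p - Y (X (\<lambda>p. f p * g p)) p) =
    (\<lambda>p. (X (Y f) p - Y (X f) p) * g p + f p * (X (Y g) p - Y (X g) p))"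
    unfolding mult[OF X Y] mult[OF Y X] by (simp add: algebra_simps)
next
  show "smooth_fun A (\<lambda>p. X (Y f) p - Y (X f) p)" if "smooth_fun A f" for f
    by (rule smooth_diff[OF vf_smooth[OF X vf_smooth[OF Y that]] vf_smooth[OF Y vf_smooth[OF X that]]])
  show "(\<lambda>p. X (Y f) p - Y (X f) p) = (\<lambda>p. 0)" if "\<not> smooth_fun A f" for f
    unfolding vf_not_smooth[OF X that] vf_not_smooth[OF Y that] vf_const[OF X] vf_const[OF Y] by simp
qed

text \<open>These identities of operators hold on all functions, not only the smooth ones: on a function
  that is not smooth the fields return 0, and a derivation annihilates 0.\<close>

lemma lie_bracket_add_right:
  "vector_field A X \<Longrightarrow> vector_field A Y \<Longrightarrow> vector_field A Y' \<Longrightarrow>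
    lie_bracket X (Y + Y') = lie_bracket X Y + lie_bracket X Y'"
  by (intro ext, rename_tac f p, case_tac "smooth_fun A f")
    (auto simp: plus_fun_def lie_bracket_def vf_add vf_smooth vf_not_smooth vf_const)

lemma lie_bracket_scale_right:
  "vector_field A X \<Longrightarrow> vector_field A Y \<Longrightarrow> smooth_fun A h \<Longrightarrow>
    lie_bracket X (h \<cdot>\<^sub>1 Y) = X h \<cdot>\<^sub>1 Y + h \<cdot>\<^sub>1 lie_bracket X Y"
  by (intro ext, rename_tac f p, case_tac "smooth_fun A f")
    (auto simp: plus_fun_def lie_bracket_def scale1_def vf_mult vf_smooth vf_not_smooth vf_const algebra_simps)

lemma lie_bracket_apply: "lie_bracket X Y f = (\<lambda>p. X (Y f) p - Y (X f) p)"
  by (simp add: lie_bracket_def)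

lemma lie_bracket_swap: "lie_bracket Y X = (\<lambda>p. - 1) \<cdot>\<^sub>1 lie_bracket X Y"
  by (simp add: lie_bracket_def scale1_def)

text \<open>The Jacobi identity, arranged so that the three brackets have the order in which they
  occur in \<open>d(d\<alpha>)\<close>.\<close>

lemma lie_bracket_Jacobi:
  "vector_field A X \<Longrightarrow> vector_field A Y \<Longrightarrow> vector_field A Z \<Longrightarrow>
    lie_bracket (lie_bracket X Z) Y = lie_bracket (lie_bracket X Y) Z + lie_bracket (lie_bracket Y Z) X"
  by (intro ext, rename_tac f p, case_tac "smooth_fun A f")
    (auto simp: plus_fun_def lie_bracket_def vf_diff vf_smooth vf_not_smooth vf_const)

section \<open>Exterior calculus of one-forms and two-forms\<close>

lemma form_smooth: "one_form A \<alpha> \<Longrightarrow> vector_field A X \<Longrightarrow> smooth_fun A (\<alpha> X)"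
  by (simp add: one_form_def)

lemma form_zero: "one_form A \<alpha> \<Longrightarrow> \<not> vector_field A X \<Longrightarrow> \<alpha> X = (\<lambda>p. 0)"
  by (simp add: one_form_def)

lemma form_add: "one_form A \<alpha> \<Longrightarrow> vector_field A X \<Longrightarrow> vector_field A Y \<Longrightarrow>
    \<alpha> (X + Y) = (\<lambda>p. \<alpha> X p + \<alpha> Y p)"
  by (simp add: one_form_def plus_fun_def)

lemma form_scale: "one_form A \<alpha> \<Longrightarrow> smooth_fun A h \<Longrightarrow> vector_field A X \<Longrightarrow>
    \<alpha> (h \<cdot>\<^sub>1 X) = (\<lambda>p. h p * \<alpha> X p)"
  by (simp add: one_form_def)

lemma form_bracket_swap:
  "one_form A \<alpha> \<Longrightarrow> vector_field A X \<Longrightarrow> vector_field A Y \<Longrightarrow>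
    \<alpha> (lie_bracket Y X) = (\<lambda>p. - \<alpha> (lie_bracket X Y) p)"
  by (simp add: lie_bracket_swap[of Y X] form_scale smooth_const vector_field_bracket)

lemma one_form_add:
  assumes \<alpha>: "one_form A \<alpha>" and \<beta>: "one_form A \<beta>"
  shows "one_form A (\<alpha> + \<beta>)"
  unfolding one_form_def
proof (intro conjI allI impI)
  show "smooth_fun A ((\<alpha> + \<beta>) X)" if "vector_field A X" for X
    using smooth_add[OF form_smooth[OF \<alpha> that] form_smooth[OF \<beta> that]] by (simp add: plus_fun_def)
qed (simp_all add: fun_eq_iff form_add[OF \<alpha>] form_add[OF \<beta>] form_scale[OF \<alpha>] form_scale[OF \<beta>]
    form_zero[OF \<alpha>] form_zero[OF \<beta>] algebra_simps)

lemma scale1_apply: "(h \<cdot>\<^sub>1 \<alpha>) X = (\<lambda>p. h p * \<alpha> X p)"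
  by (simp add: scale1_def)

lemma one_form_scale:
  assumes \<alpha>: "one_form A \<alpha>" and h: "smooth_fun A h"
  shows "one_form A (h \<cdot>\<^sub>1 \<alpha>)"
  unfolding one_form_def scale1_apply[of h \<alpha>]
proof (intro conjI allI impI)
  show "smooth_fun A (\<lambda>p. h p * \<alpha> X p)" if "vector_field A X" for X
    by (rule smooth_mult[OF h form_smooth[OF \<alpha> that]])
qed (simp_all add: fun_eq_iff form_add[OF \<alpha>] form_scale[OF \<alpha>] form_zero[OF \<alpha>] algebra_simps)

text \<open>The case distinction makes this a one-form in the sense of \<open>one_form\<close>, which vanishes on
  arguments that are not vector fields; for such an \<open>X\<close> the value \<open>X f\<close> can be anything.\<close>

definition differential :: "('a \<Rightarrow> real) \<Rightarrow> 'a form1" where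
  "differential f = (\<lambda>X p. if vector_field A X then X f p else 0)"

lemma one_form_differential:
  assumes f: "smooth_fun A f"
  shows "one_form A (differential f)"
  unfolding one_form_def
proof (intro conjI allI impI)
  show "smooth_fun A (differential f X)" if "vector_field A X" for X
    using vf_smooth[OF that f] that by (simp add: differential_def)
qed (simp_all add: fun_eq_iff differential_def vector_field_add vector_field_scale scale1_apply)

lemma ext_deriv1_eq: "vector_field A X \<Longrightarrow> vector_field A Y \<Longrightarrow>
    ext_deriv1 A \<alpha> X Y = (\<lambda>p. X (\<alpha> Y) p - Y (\<alpha> X) p - \<alpha> (lie_bracket X Y) p)"
  by (simp add: ext_deriv1_def)

lemma ext_deriv1_zero: "\<not> (vector_field A X \<and> vector_field A Y) \<Longrightarrow> ext_deriv1 A \<alpha> X Y = (\<lambda>p. 0)"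
  by (auto simp: ext_deriv1_def)

lemma ext_deriv1_smooth:
  "one_form A \<alpha> \<Longrightarrow> vector_field A X \<Longrightarrow> vector_field A Y \<Longrightarrow> smooth_fun A (ext_deriv1 A \<alpha> X Y)"
  by (simp add: ext_deriv1_eq smooth_diff vf_smooth form_smooth vector_field_bracket)

lemma ext_deriv1_swap:
  "one_form A \<alpha> \<Longrightarrow> ext_deriv1 A \<alpha> Y X = (\<lambda>p. - ext_deriv1 A \<alpha> X Y p)"
  by (cases "vector_field A X \<and> vector_field A Y")
    (auto simp: ext_deriv1_eq ext_deriv1_zero form_bracket_swap[of \<alpha> X Y])

text \<open>Linearity over the functions is the tensoriality of \<open>d\<alpha>\<close>: the product rule in
  \<open>Z(h \<alpha>(X))\<close> produces \<open>Z(h) \<alpha>(X)\<close>, which cancels against the same term from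
  \<open>[Z, h X] = Z(h) X + h [Z, X]\<close>.\<close>

lemma one_form_interior:
  assumes \<alpha>: "one_form A \<alpha>" and Z: "vector_field A Z"
  shows "one_form A (interior_product Z (ext_deriv1 A \<alpha>))"
  unfolding one_form_def interior_product_def
proof (intro conjI allI impI)
  show "smooth_fun A (ext_deriv1 A \<alpha> Z X)" if "vector_field A X" for X
    using assms that by (rule ext_deriv1_smooth)
  show "ext_deriv1 A \<alpha> Z (X + Y) = ext_deriv1 A \<alpha> Z X + ext_deriv1 A \<alpha> Z Y"
    if "vector_field A X" "vector_field A Y" for X Y
    using assms that
    by (simp add: ext_deriv1_eq vector_field_add form_add vf_add form_smooth lie_bracket_add_right
        vector_field_bracket) (simp add: fun_eq_iff)
  show "ext_deriv1 A \<alpha> Z (h \<cdot>\<^sub>1 X) = (\<lambda>p. h p * ext_deriv1 A \<alpha> Z X p)"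
    if "smooth_fun A h" "vector_field A X" for h X
    using assms that
    by (simp add: ext_deriv1_eq vector_field_scale form_scale vf_mult form_smooth
        lie_bracket_scale_right vector_field_bracket form_add vf_smooth)
      (simp add: scale1_apply algebra_simps)
  show "ext_deriv1 A \<alpha> Z X = (\<lambda>p. 0)" if "\<not> vector_field A X" for X
    using that by (simp add: ext_deriv1_zero)
qed

lemma ext_deriv1_add:
  assumes "one_form A \<alpha>" "one_form A \<beta>"
  shows "ext_deriv1 A (\<alpha> + \<beta>) = ext_deriv1 A \<alpha> + ext_deriv1 A \<beta>"
proof (intro ext)
  fix X Y p
  show "ext_deriv1 A (\<alpha> + \<beta>) X Y p = (ext_deriv1 A \<alpha> + ext_deriv1 A \<beta>) X Y p"
    using assms
    by (cases "vector_field A X \<and> vector_field A Y")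
      (auto simp: ext_deriv1_eq ext_deriv1_zero plus_fun_def[of \<alpha> \<beta>] plus_fun_def[of "\<alpha> _" "\<beta> _"]
        vf_add form_smooth)
qed

lemma ext_deriv1_scale:
  assumes "one_form A \<alpha>" "smooth_fun A h"
  shows "ext_deriv1 A (h \<cdot>\<^sub>1 \<alpha>) = differential h \<and>\<^sub>1\<^sub>1 \<alpha> + h \<cdot>\<^sub>2 ext_deriv1 A \<alpha>"
proof (intro ext)
  fix X Y p
  show "ext_deriv1 A (h \<cdot>\<^sub>1 \<alpha>) X Y p = (differential h \<and>\<^sub>1\<^sub>1 \<alpha> + h \<cdot>\<^sub>2 ext_deriv1 A \<alpha>) X Y p"
    using assms
    by (cases "vector_field A X \<and> vector_field A Y")
      (auto simp: ext_deriv1_eq ext_deriv1_zero scale1_apply scale2_def differential_def wedge11_def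
        vf_mult form_smooth form_zero algebra_simps)
qed

lemma ext_deriv1_differential:
  "ext_deriv1 A (differential f) = (\<lambda>X Y p. 0)"
proof (intro ext)
  fix X Y p
  show "ext_deriv1 A (differential f) X Y p = 0"
    by (cases "vector_field A X \<and> vector_field A Y")
      (auto simp: ext_deriv1_eq ext_deriv1_zero differential_def vector_field_bracket,
        auto simp: lie_bracket_def)
qed

text \<open>The properties of a two-form that make \<open>d\<close> additive and subject to the Leibniz rule for
  \<open>f \<theta>\<close>: derivations are additive on smooth functions only, and the identities between
  forms are to hold for all arguments, vector fields or not.\<close>

definition smooth_form2 :: "'a form2 \<Rightarrow> bool" where
  "smooth_form2 \<theta> \<longleftrightarrow>
     (\<forall>X Y. vector_field A X \<longrightarrow> vector_field A Y \<longrightarrow> smooth_fun A (\<theta> X Y)) \<and>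
     (\<forall>X Y. \<not> (vector_field A X \<and> vector_field A Y) \<longrightarrow> \<theta> X Y = (\<lambda>p. 0))"

lemma smooth_form2D:
  assumes "smooth_form2 \<theta>"
  shows "vector_field A X \<Longrightarrow> vector_field A Y \<Longrightarrow> smooth_fun A (\<theta> X Y)"
    and "\<not> vector_field A X \<Longrightarrow> \<theta> X Y = (\<lambda>p. 0)"
    and "\<not> vector_field A Y \<Longrightarrow> \<theta> X Y = (\<lambda>p. 0)"
  using assms by (auto simp: smooth_form2_def)

lemma smooth_form2_ext_deriv1: "one_form A \<alpha> \<Longrightarrow> smooth_form2 (ext_deriv1 A \<alpha>)"
  by (auto simp: smooth_form2_def ext_deriv1_smooth ext_deriv1_zero)

lemma smooth_form2_wedge: "one_form A \<alpha> \<Longrightarrow> one_form A \<beta> \<Longrightarrow> smooth_form2 (\<alpha> \<and>\<^sub>1\<^sub>1 \<beta>)"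
  by (auto simp: smooth_form2_def wedge11_def form_zero smooth_diff smooth_mult form_smooth)

lemma smooth_form2_scale: "smooth_form2 \<theta> \<Longrightarrow> smooth_fun A h \<Longrightarrow> smooth_form2 (h \<cdot>\<^sub>2 \<theta>)"
  by (auto simp: smooth_form2_def scale2_def intro!: smooth_mult)

lemma smooth_form2_add: "smooth_form2 \<theta> \<Longrightarrow> smooth_form2 \<theta>' \<Longrightarrow> smooth_form2 (\<theta> + \<theta>')"
  by (auto simp: smooth_form2_def plus_fun_def intro!: smooth_add)

lemma smooth_form2_minus: "smooth_form2 \<theta> \<Longrightarrow> smooth_form2 (- \<theta>)"
  by (auto simp: smooth_form2_def fun_Compl_def intro!: smooth_minus)

lemma smooth_form2_diff: "smooth_form2 \<theta> \<Longrightarrow> smooth_form2 \<theta>' \<Longrightarrow> smooth_form2 (\<theta> - \<theta>')"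
  by (auto simp: smooth_form2_def fun_diff_def intro!: smooth_diff)

lemma ext_deriv2_add:
  assumes "smooth_form2 \<theta>" "smooth_form2 \<theta>'"
  shows "ext_deriv2 A (\<theta> + \<theta>') = ext_deriv2 A \<theta> + ext_deriv2 A \<theta>'"
  using assms
  by (auto simp: ext_deriv2_def fun_eq_iff plus_fun_def vf_add smooth_form2D)

lemma ext_deriv2_minus:
  assumes "smooth_form2 \<theta>"
  shows "ext_deriv2 A (- \<theta>) = - ext_deriv2 A \<theta>"
  using assms
  by (auto simp: ext_deriv2_def fun_eq_iff fun_Compl_def vf_minus smooth_form2D)

lemma ext_deriv2_diff:
  assumes "smooth_form2 \<theta>" "smooth_form2 \<theta>'"
  shows "ext_deriv2 A (\<theta> - \<theta>') = ext_deriv2 A \<theta> - ext_deriv2 A \<theta>'"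
  using assms
  by (auto simp: ext_deriv2_def fun_eq_iff fun_diff_def vf_diff smooth_form2D)

lemma ext_deriv2_scale:
  assumes "smooth_form2 \<theta>" "smooth_fun A f"
  shows "ext_deriv2 A (f \<cdot>\<^sub>2 \<theta>) = differential f \<and>\<^sub>1\<^sub>2 \<theta> + f \<cdot>\<^sub>3 ext_deriv2 A \<theta>"
  using assms
  by (auto simp: ext_deriv2_def fun_eq_iff scale2_def scale3_def wedge12_def differential_def
      vf_mult smooth_form2D algebra_simps)

lemma ext_deriv2_wedge:
  assumes "one_form A \<alpha>" "one_form A \<beta>"
  shows "ext_deriv2 A (\<alpha> \<and>\<^sub>1\<^sub>1 \<beta>) = ext_deriv1 A \<alpha> \<and>\<^sub>2\<^sub>1 \<beta> - \<alpha> \<and>\<^sub>1\<^sub>2 ext_deriv1 A \<beta>"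
proof (intro ext)
  fix X Y Z p
  show "ext_deriv2 A (\<alpha> \<and>\<^sub>1\<^sub>1 \<beta>) X Y Z p = (ext_deriv1 A \<alpha> \<and>\<^sub>2\<^sub>1 \<beta> - \<alpha> \<and>\<^sub>1\<^sub>2 ext_deriv1 A \<beta>) X Y Z p"
  proof (cases "vector_field A X \<and> vector_field A Y \<and> vector_field A Z")
    case True
    then have v: "vector_field A X" "vector_field A Y" "vector_field A Z" by auto
    have leibniz: "U (\<lambda>p. \<alpha> V p * \<beta> W p - \<alpha> W p * \<beta> V p) p =
        U (\<alpha> V) p * \<beta> W p + \<alpha> V p * U (\<beta> W) p - (U (\<alpha> W) p * \<beta> V p + \<alpha> W p * U (\<beta> V) p)"
      if "vector_field A U" "vector_field A V" "vector_field A W" for U V W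
      by (simp add: vf_diff[OF that(1)] vf_mult[OF that(1)] form_smooth assms that smooth_mult)
    show ?thesis
      using v
      by (simp add: ext_deriv2_def wedge11_def wedge12_def wedge21_def ext_deriv1_eq leibniz)
        (simp add: algebra_simps)
  next
    case False
    then show ?thesis
      using assms
      by (auto simp: ext_deriv2_def wedge12_def wedge21_def ext_deriv1_zero form_zero)
  qed
qed

text \<open>The second derivatives of the components \<open>\<alpha> X\<close>, \<open>\<alpha> Y\<close>, \<open>\<alpha> Z\<close> combine to brackets acting
  on these functions, which cancel, and the values of \<open>\<alpha>\<close> on double brackets cancel by the
  Jacobi identity.\<close>

lemma ext_deriv2_ext_deriv1:
  assumes "one_form A \<alpha>"
  shows "ext_deriv2 A (ext_deriv1 A \<alpha>) = (\<lambda>X Y Z p. 0)"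
proof (intro ext)
  fix X Y Z p
  show "ext_deriv2 A (ext_deriv1 A \<alpha>) X Y Z p = 0"
  proof (cases "vector_field A X \<and> vector_field A Y \<and> vector_field A Z")
    case True
    then have v: "vector_field A X" "vector_field A Y" "vector_field A Z" by auto
    have jac: "\<alpha> (lie_bracket (lie_bracket X Z) Y) p =
        \<alpha> (lie_bracket (lie_bracket X Y) Z) p + \<alpha> (lie_bracket (lie_bracket Y Z) X) p"
      using assms v by (simp add: lie_bracket_Jacobi[OF v] form_add vector_field_bracket)
    have expand: "U (ext_deriv1 A \<alpha> V W) p = U (V (\<alpha> W)) p - U (W (\<alpha> V)) p - U (\<alpha> (lie_bracket V W)) p"
      if U: "vector_field A U" and V: "vector_field A V" and W: "vector_field A W" for U V W
      using vf_smooth[OF V form_smooth[OF assms W]] vf_smooth[OF W form_smooth[OF assms V]]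
        form_smooth[OF assms vector_field_bracket[OF V W]]
      by (simp only: ext_deriv1_eq[OF V W] vf_diff[OF U] smooth_diff)
    note bracket = vector_field_bracket[OF v(1,2)] vector_field_bracket[OF v(1,3)] vector_field_bracket[OF v(2,3)]
    show ?thesis
      unfolding ext_deriv2_def using True
      by (simp only: expand v ext_deriv1_eq[OF bracket(1) v(3)] ext_deriv1_eq[OF bracket(2) v(2)]
          ext_deriv1_eq[OF bracket(3) v(1)] jac lie_bracket_apply) simp
  qed (auto simp: ext_deriv2_def)
qed

text \<open>The mixed terms are \<open>\<beta> \<and> d\<eta> + \<eta> \<and> d\<beta>\<close>; the Leibniz rule trades the second for
  \<open>d\<eta> \<and> \<beta> - d(\<eta> \<and> \<beta>)\<close>, so that \<open>d\<eta> \<and> \<beta>\<close> appears twice.\<close>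

lemma wedge_ext_deriv1_perturbed:
  assumes "one_form A \<eta>" "one_form A \<beta>"
  shows "(\<eta> + \<beta>) \<and>\<^sub>1\<^sub>2 ext_deriv1 A (\<eta> + \<beta>) =
    \<eta> \<and>\<^sub>1\<^sub>2 ext_deriv1 A \<eta> - ext_deriv2 A (\<eta> \<and>\<^sub>1\<^sub>1 \<beta>)
    + (\<lambda>p. 2) \<cdot>\<^sub>3 (ext_deriv1 A \<eta> \<and>\<^sub>2\<^sub>1 \<beta>) + \<beta> \<and>\<^sub>1\<^sub>2 ext_deriv1 A \<beta>"
  unfolding ext_deriv1_add[OF assms] ext_deriv2_wedge[OF assms]
  by (simp add: fun_eq_iff wedge12_def wedge21_def scale3_def algebra_simps)

text \<open>Linearity in the field that is inserted follows from linearity in the other argument, since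
  \<open>d\<alpha>\<close> is antisymmetric.\<close>

lemma interior_add:
  assumes "one_form A \<alpha>" "vector_field A Y" "vector_field A Z"
  shows "interior_product (Y + Z) (ext_deriv1 A \<alpha>) =
    interior_product Y (ext_deriv1 A \<alpha>) + interior_product Z (ext_deriv1 A \<alpha>)"
proof (intro ext)
  fix X p
  show "interior_product (Y + Z) (ext_deriv1 A \<alpha>) X p =
    (interior_product Y (ext_deriv1 A \<alpha>) + interior_product Z (ext_deriv1 A \<alpha>)) X p"
  proof (cases "vector_field A X")
    case True
    then show ?thesis
      using form_add[OF one_form_interior[OF assms(1) True] assms(2,3)]
      by (simp add: interior_product_def ext_deriv1_swap[OF assms(1), of _ X])
  qed (simp add: interior_product_def ext_deriv1_zero)
qed

lemma interior_scale:
  assumes "one_form A \<alpha>" "vector_field A Z" "smooth_fun A h"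
  shows "interior_product (h \<cdot>\<^sub>1 Z) (ext_deriv1 A \<alpha>) = h \<cdot>\<^sub>1 interior_product Z (ext_deriv1 A \<alpha>)"
proof (intro ext)
  fix X p
  show "interior_product (h \<cdot>\<^sub>1 Z) (ext_deriv1 A \<alpha>) X p = (h \<cdot>\<^sub>1 interior_product Z (ext_deriv1 A \<alpha>)) X p"
  proof (cases "vector_field A X")
    case True
    then show ?thesis
      using form_scale[OF one_form_interior[OF assms(1) True] assms(3,2)]
      by (simp add: interior_product_def ext_deriv1_swap[OF assms(1), of _ X] scale1_apply)
  qed (simp add: interior_product_def ext_deriv1_zero scale1_apply)
qed

section \<open>Deformations of the pair\<close>

text \<open>At each point the factor is found by inserting \<open>T\<close>: it is \<open>\<omega>'(T) = e\<^sup>f \<omega>'(e\<^sup>-\<^sup>f T) = e\<^sup>f\<close>.\<close>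

lemma parallel_conformal_factor:
  assumes \<omega>: "one_form A \<omega>" and T: "vector_field A T" and \<omega>T: "\<And>p. \<omega> T p = 1"
    and \<omega>': "one_form A \<omega>'" and f: "smooth_fun A f"
    and \<omega>'T: "\<And>p. \<omega>' ((\<lambda>p. exp (- f p)) \<cdot>\<^sub>1 T) p = 1" and par: "parallel_to A \<omega>' \<omega>"
  shows "\<omega>' = (\<lambda>p. exp (f p)) \<cdot>\<^sub>1 \<omega>"
proof (intro ext)
  fix X p
  obtain c where c: "\<And>X. vector_field A X \<Longrightarrow> \<omega>' X p = c * \<omega> X p"
    using par by (auto simp: parallel_to_def)
  have "exp (- f p) * c = 1"
    using \<omega>'T[of p] c[OF T] \<omega>T by (simp add: form_scale \<omega>' T smooth_exp smooth_minus f)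
  then have "c = exp (f p)" by (simp add: exp_minus field_simps)
  then show "\<omega>' X p = ((\<lambda>p. exp (f p)) \<cdot>\<^sub>1 \<omega>) X p"
    using c by (cases "vector_field A X") (auto simp: scale1_apply form_zero \<omega> \<omega>')
qed

text \<open>This is \<open>\<iota>\<^sub>T (df \<and> \<omega> + d\<omega>)\<close> with \<open>\<omega>(T) = 1\<close>: the two exponential factors cancel
  once the chain rule has turned \<open>d(e\<^sup>f)\<close> into \<open>e\<^sup>f df\<close>.\<close>

lemma interior_conformal:
  assumes \<omega>: "one_form A \<omega>" and T: "vector_field A T" and \<omega>T: "\<And>p. \<omega> T p = 1"
    and f: "smooth_fun A f"
  shows "interior_product ((\<lambda>p. exp (- f p)) \<cdot>\<^sub>1 T) (ext_deriv1 A ((\<lambda>p. exp (f p)) \<cdot>\<^sub>1 \<omega>)) =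
    (interior_product T (ext_deriv1 A \<omega>) + T f \<cdot>\<^sub>1 \<omega>) + differential (\<lambda>p. - f p)"
proof -
  have "interior_product ((\<lambda>p. exp (- f p)) \<cdot>\<^sub>1 T) (ext_deriv1 A ((\<lambda>p. exp (f p)) \<cdot>\<^sub>1 \<omega>)) =
    (\<lambda>p. exp (- f p)) \<cdot>\<^sub>1 interior_product T
      (differential (\<lambda>p. exp (f p)) \<and>\<^sub>1\<^sub>1 \<omega> + (\<lambda>p. exp (f p)) \<cdot>\<^sub>2 ext_deriv1 A \<omega>)"
    unfolding interior_scale[OF one_form_scale[OF \<omega> smooth_exp[OF f]] T smooth_exp[OF smooth_minus[OF f]]]
    unfolding ext_deriv1_scale[OF \<omega> smooth_exp[OF f]] ..
  also have "\<dots> = (interior_product T (ext_deriv1 A \<omega>) + T f \<cdot>\<^sub>1 \<omega>) + differential (\<lambda>p. - f p)"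
    using \<omega> T f
    by (auto simp: fun_eq_iff scale1_apply scale2_def wedge11_def interior_product_def
        differential_def vf_exp vf_minus \<omega>T form_zero exp_minus field_simps)
  finally show ?thesis .
qed

text \<open>The form \<open>\<eta>'\<close> of \<open>interior_conformal\<close>, with \<open>g = T(f)\<close>. Its exact part \<open>- df\<close> does not
  contribute to \<open>d\<eta>'\<close>, and the wedge product of \<open>- df\<close> with the closed form \<open>d\<eta>'\<close> is exact:
  this is the part \<open>- f d\<eta> - f d(g \<omega>)\<close> of \<open>\<alpha>\<close>. The remaining part \<open>g \<omega> \<and> \<eta>\<close> comes from
  moving \<open>d\<close> off \<open>g \<omega>\<close> in \<open>\<eta> \<and> d(g \<omega>)\<close>.\<close>

lemma wedge_ext_deriv1_conformal:
  assumes \<omega>: "one_form A \<omega>" and \<eta>: "one_form A \<eta>" and f: "smooth_fun A f" and g: "smooth_fun A g"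
    and \<eta>': "\<eta>' = (\<eta> + g \<cdot>\<^sub>1 \<omega>) + differential (\<lambda>p. - f p)"
    and \<alpha>: "\<alpha> = - (f \<cdot>\<^sub>2 ext_deriv1 A \<eta>) - f \<cdot>\<^sub>2 ext_deriv1 A (g \<cdot>\<^sub>1 \<omega>) + (g \<cdot>\<^sub>1 \<omega>) \<and>\<^sub>1\<^sub>1 \<eta>"
  shows "\<eta>' \<and>\<^sub>1\<^sub>2 ext_deriv1 A \<eta>' =
    \<eta> \<and>\<^sub>1\<^sub>2 ext_deriv1 A \<eta> + ext_deriv2 A \<alpha>
    + (\<lambda>p. 2 * g p) \<cdot>\<^sub>3 (\<omega> \<and>\<^sub>1\<^sub>2 ext_deriv1 A \<eta>)
    + (\<lambda>p. (g p)\<^sup>2) \<cdot>\<^sub>3 (\<omega> \<and>\<^sub>1\<^sub>2 ext_deriv1 A \<omega>)"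
proof -
  define \<theta> where "\<theta> = ext_deriv1 A (g \<cdot>\<^sub>1 \<omega>)"
  have g\<omega>: "one_form A (g \<cdot>\<^sub>1 \<omega>)" using \<omega> g by (rule one_form_scale)
  have df: "differential (\<lambda>p. - f p) = - differential f"
    using f by (auto simp: differential_def fun_eq_iff vf_minus)
  have d\<eta>': "ext_deriv1 A \<eta>' = ext_deriv1 A \<eta> + \<theta>"
    unfolding \<eta>' \<theta>_def using \<eta> g\<omega> f
    by (simp add: ext_deriv1_add one_form_add one_form_differential smooth_minus
        ext_deriv1_differential) (simp add: fun_eq_iff)
  have d\<alpha>: "ext_deriv2 A \<alpha> = - (differential f \<and>\<^sub>1\<^sub>2 ext_deriv1 A \<eta>) - differential f \<and>\<^sub>1\<^sub>2 \<theta>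
      + (\<theta> \<and>\<^sub>2\<^sub>1 \<eta> - (g \<cdot>\<^sub>1 \<omega>) \<and>\<^sub>1\<^sub>2 ext_deriv1 A \<eta>)"
    unfolding \<alpha> \<theta>_def using \<eta> g\<omega> f
    by (simp add: ext_deriv2_add ext_deriv2_minus ext_deriv2_diff ext_deriv2_scale ext_deriv2_wedge
        ext_deriv2_ext_deriv1 smooth_form2_add smooth_form2_minus smooth_form2_diff smooth_form2_scale
        smooth_form2_wedge smooth_form2_ext_deriv1)
      (simp add: fun_eq_iff scale3_def)
  (* the other term of d(g \<omega>), namely dg \<and> \<omega>, contains \<omega> and is killed by it *)
  have sq: "(g \<cdot>\<^sub>1 \<omega>) \<and>\<^sub>1\<^sub>2 \<theta> = (\<lambda>p. (g p)\<^sup>2) \<cdot>\<^sub>3 (\<omega> \<and>\<^sub>1\<^sub>2 ext_deriv1 A \<omega>)"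
    unfolding \<theta>_def ext_deriv1_scale[OF \<omega> g]
    by (simp add: fun_eq_iff wedge12_def wedge11_def scale1_apply scale2_def scale3_def
        algebra_simps power2_eq_square)
  have "\<eta>' \<and>\<^sub>1\<^sub>2 ext_deriv1 A \<eta>' =
    \<eta> \<and>\<^sub>1\<^sub>2 ext_deriv1 A \<eta> + ext_deriv2 A \<alpha>
    + (\<lambda>p. 2 * g p) \<cdot>\<^sub>3 (\<omega> \<and>\<^sub>1\<^sub>2 ext_deriv1 A \<eta>) + (g \<cdot>\<^sub>1 \<omega>) \<and>\<^sub>1\<^sub>2 \<theta>"
    unfolding d\<eta>' d\<alpha> unfolding \<eta>' df
    by (simp add: fun_eq_iff wedge12_def wedge21_def scale1_apply scale3_def algebra_simps)
  then show ?thesis by (simp only: sq)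
qed

end

theorem proposition1:
  fixes A :: "('a::t2_space set \<times> ('a \<Rightarrow> real^3)) set"
    and \<omega> \<omega>' \<eta> \<eta>' :: "'a form1"
    and T T' :: "'a vfield"
    and D :: "'a vfield set"
  assumes M: "compact_smooth_manifold A"
    and \<omega>: "one_form A \<omega>" and T: "vector_field A T" and \<omega>T: "\<And>p. \<omega> T p = 1"
    and \<omega>': "one_form A \<omega>'" and T': "vector_field A T'" and \<omega>T': "\<And>p. \<omega>' T' p = 1"
    and D: "D = ker_form A \<omega>"
    and \<eta>: "\<eta> = interior_product T (ext_deriv1 A \<omega>)"
    and \<eta>': "\<eta>' = interior_product T' (ext_deriv1 A \<omega>')"
  shows
    "(\<forall>f. smooth_fun A f \<and> T' = (\<lambda>p. exp (- f p)) \<cdot>\<^sub>1 T \<and> parallel_to A \<omega>' \<omega> \<longrightarrow>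
        \<omega>' = (\<lambda>p. exp (f p)) \<cdot>\<^sub>1 \<omega> \<and>
        (let \<alpha> = - (f \<cdot>\<^sub>2 ext_deriv1 A \<eta>) - f \<cdot>\<^sub>2 ext_deriv1 A (T f \<cdot>\<^sub>1 \<omega>) + (T f \<cdot>\<^sub>1 \<omega>) \<and>\<^sub>1\<^sub>1 \<eta>
         in \<eta>' \<and>\<^sub>1\<^sub>2 ext_deriv1 A \<eta>' =
              \<eta> \<and>\<^sub>1\<^sub>2 ext_deriv1 A \<eta> + ext_deriv2 A \<alpha>
              + (\<lambda>p. 2 * T f p) \<cdot>\<^sub>3 (\<omega> \<and>\<^sub>1\<^sub>2 ext_deriv1 A \<eta>)
              + (\<lambda>p. (T f p)\<^sup>2) \<cdot>\<^sub>3 (\<omega> \<and>\<^sub>1\<^sub>2 ext_deriv1 A \<omega>)))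
     \<and>
     (\<forall>X. X \<in> D \<and> T' = T + X \<and> \<omega>' = \<omega> \<longrightarrow>
        (let \<beta> = interior_product X (ext_deriv1 A \<omega>)
         in \<eta>' = \<eta> + \<beta> \<and>
            \<eta>' \<and>\<^sub>1\<^sub>2 ext_deriv1 A \<eta>' =
              \<eta> \<and>\<^sub>1\<^sub>2 ext_deriv1 A \<eta> - ext_deriv2 A (\<eta> \<and>\<^sub>1\<^sub>1 \<beta>)
              + (\<lambda>p. 2) \<cdot>\<^sub>3 (ext_deriv1 A \<eta> \<and>\<^sub>2\<^sub>1 \<beta>)
              + \<beta> \<and>\<^sub>1\<^sub>2 ext_deriv1 A \<beta>))
     \<and>
     (\<forall>\<mu>. one_form A \<mu> \<and> T' = T \<and> \<omega>' = \<omega> + \<mu> \<longrightarrow>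
        (\<forall>p. \<mu> T p = 0) \<and>
        (let \<beta> = interior_product T (ext_deriv1 A \<mu>)
         in \<eta>' = \<eta> + \<beta> \<and>
            \<eta>' \<and>\<^sub>1\<^sub>2 ext_deriv1 A \<eta>' =
              \<eta> \<and>\<^sub>1\<^sub>2 ext_deriv1 A \<eta> - ext_deriv2 A (\<eta> \<and>\<^sub>1\<^sub>1 \<beta>)
              + (\<lambda>p. 2) \<cdot>\<^sub>3 (ext_deriv1 A \<eta> \<and>\<^sub>2\<^sub>1 \<beta>)
              + \<beta> \<and>\<^sub>1\<^sub>2 ext_deriv1 A \<beta>))"
proof -
  interpret atlas A
    using M by unfold_locales (simp add: compact_smooth_manifold_def)
  have \<eta>1: "one_form A \<eta>"
    unfolding \<eta> using \<omega> T by (rule one_form_interior)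
  show ?thesis
    unfolding Let_def
  proof (intro conjI allI impI; (elim conjE)?)
    fix f
    assume f: "smooth_fun A f" and T'f: "T' = (\<lambda>p. exp (- f p)) \<cdot>\<^sub>1 T" and par: "parallel_to A \<omega>' \<omega>"
    show \<omega>'f: "\<omega>' = (\<lambda>p. exp (f p)) \<cdot>\<^sub>1 \<omega>"
      by (rule parallel_conformal_factor[OF \<omega> T \<omega>T \<omega>' f \<omega>T'[unfolded T'f] par])
    have "\<eta>' = (\<eta> + T f \<cdot>\<^sub>1 \<omega>) + differential (\<lambda>p. - f p)"
      unfolding \<eta>' \<eta> T'f \<omega>'f by (rule interior_conformal[of \<omega> T f, OF \<omega> T \<omega>T f])
    from wedge_ext_deriv1_conformal[OF \<omega> \<eta>1 f vf_smooth[OF T f] this refl]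
    show "\<eta>' \<and>\<^sub>1\<^sub>2 ext_deriv1 A \<eta>' =
              \<eta> \<and>\<^sub>1\<^sub>2 ext_deriv1 A \<eta> + ext_deriv2 A (- (f \<cdot>\<^sub>2 ext_deriv1 A \<eta>) - f \<cdot>\<^sub>2 ext_deriv1 A (T f \<cdot>\<^sub>1 \<omega>) + (T f \<cdot>\<^sub>1 \<omega>) \<and>\<^sub>1\<^sub>1 \<eta>)
              + (\<lambda>p. 2 * T f p) \<cdot>\<^sub>3 (\<omega> \<and>\<^sub>1\<^sub>2 ext_deriv1 A \<eta>)
              + (\<lambda>p. (T f p)\<^sup>2) \<cdot>\<^sub>3 (\<omega> \<and>\<^sub>1\<^sub>2 ext_deriv1 A \<omega>)" .
  next
    fix X
    let ?\<beta> = "interior_product X (ext_deriv1 A \<omega>)"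
    assume X: "X \<in> D" and T'X: "T' = T + X" and \<omega>'\<omega>: "\<omega>' = \<omega>"
    have X: "vector_field A X" using X by (simp add: D ker_form_def)
    show \<eta>'\<beta>: "\<eta>' = \<eta> + ?\<beta>"
      unfolding \<eta>' \<eta> T'X \<omega>'\<omega> by (rule interior_add[OF \<omega> T X])
    show "\<eta>' \<and>\<^sub>1\<^sub>2 ext_deriv1 A \<eta>' =
              \<eta> \<and>\<^sub>1\<^sub>2 ext_deriv1 A \<eta> - ext_deriv2 A (\<eta> \<and>\<^sub>1\<^sub>1 ?\<beta>)
              + (\<lambda>p. 2) \<cdot>\<^sub>3 (ext_deriv1 A \<eta> \<and>\<^sub>2\<^sub>1 ?\<beta>)
              + ?\<beta> \<and>\<^sub>1\<^sub>2 ext_deriv1 A ?\<beta>"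
      unfolding \<eta>'\<beta> by (rule wedge_ext_deriv1_perturbed[OF \<eta>1 one_form_interior[OF \<omega> X]])
  next
    fix \<mu> p
    assume "T' = T" and "\<omega>' = \<omega> + \<mu>"
    then show "\<mu> T p = 0" using \<omega>T[of p] \<omega>T'[of p] by simp
  next
    fix \<mu>
    let ?\<beta> = "interior_product T (ext_deriv1 A \<mu>)"
    assume \<mu>: "one_form A \<mu>" and T'T: "T' = T" and \<omega>'\<mu>: "\<omega>' = \<omega> + \<mu>"
    show \<eta>'\<beta>: "\<eta>' = \<eta> + ?\<beta>"
      unfolding \<eta>' \<eta> T'T \<omega>'\<mu> ext_deriv1_add[OF \<omega> \<mu>]
      by (simp add: interior_product_def fun_eq_iff)
    show "\<eta>' \<and>\<^sub>1\<^sub>2 ext_deriv1 A \<eta>' =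
              \<eta> \<and>\<^sub>1\<^sub>2 ext_deriv1 A \<eta> - ext_deriv2 A (\<eta> \<and>\<^sub>1\<^sub>1 ?\<beta>)
              + (\<lambda>p. 2) \<cdot>\<^sub>3 (ext_deriv1 A \<eta> \<and>\<^sub>2\<^sub>1 ?\<beta>)
              + ?\<beta> \<and>\<^sub>1\<^sub>2 ext_deriv1 A ?\<beta>"
      unfolding \<eta>'\<beta> by (rule wedge_ext_deriv1_perturbed[OF \<eta>1 one_form_interior[OF \<mu> T]])
  qed
qed

end
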